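(* For every monoid $M$, exactly one of the following holds: (1) The subsets $\mathfrak{R}(M)$, $\mathfrak{L}(M)$, and $\mathfrak{E}(M)$ coincide and constitute a finite group. (2) $\mathfrak{R}(M)$ and $\mathfrak{L}(M)$ each contain an infinite ascending chain. In particular, there exist infinite sets $S\subseteq\mathfrak{R}(M)$ and $S'\subseteq\mathfrak{L}(M)$ such that $\overrightarrow{\mathfrak{I}}(s)\cap\overrightarrow{\mathfrak{I}}(t)=\emptyset$ for all $s,t\in S$ with $s\ne t$, and $\overleftarrow{\mathfrak{I}}(s')\cap\overleftarrow{\mathfrak{I}}(t')=\emptyset$ for all $s',t'\in S'$ with $s'\ne t'$.
   Context: For a monoid $M$ (operation by juxtaposition, neutral element $1$): $\mathfrak{R}(M)=\{a\in M\mid\exists b\in M: ab=1\}$, $\mathfrak{L}(M)=\{a\in M\mid\exists b\in M: ba=1\}$, $\mathfrak{E}(M)=\{a\in M\mid\exists b,c\in M: bac=1\}$. The sets $\mathfrak{R}(M)$ and $\mathfrak{L}(M)$ are submonoids of $M$. For $a\in M$: $\overrightarrow{\mathfrak{I}}(a)=\{b\in M\mid ab=1\}$ and $\overleftarrow{\mathfrak{I}}(a)=\{b\in M\mid ba=1\}$. For a monoid $K$ and $a,b\in K$, write $a\sqsubseteq b$ iff there are $c,d\in K$ with $b=ac=da$. An infinite ascending chain in $K$ is an infinite sequence $x_1,x_2,\ldots$ of pairwise distinct elements of $K$ such that $x_i\sqsubseteq x_{i+1}$ for all $i$. In (2), this notion is applied to the monoids $K=\mathfrak{R}(M)$ and $K=\mathfrak{L}(M)$.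 *)

theory Defs
  imports "HOL-Algebra.Group"
begin

definition right_invertibles :: "('a, 'b) monoid_scheme \<Rightarrow> 'a set" where
  "right_invertibles M = {a \<in> carrier M. \<exists>b\<in>carrier M. a \<otimes>\<^bsub>M\<^esub> b = \<one>\<^bsub>M\<^esub>}"

definition left_invertibles :: "('a, 'b) monoid_scheme \<Rightarrow> 'a set" where
  "left_invertibles M = {a \<in> carrier M. \<exists>b\<in>carrier M. b \<otimes>\<^bsub>M\<^esub> a = \<one>\<^bsub>M\<^esub>}"

definition unit_factors :: "('a, 'b) monoid_scheme \<Rightarrow> 'a set" where
  "unit_factors M =
    {a \<in> carrier M. \<exists>b\<in>carrier M. \<exists>c\<in>carrier M. b \<otimes>\<^bsub>M\<^esub> a \<otimes>\<^bsub>M\<^esub> c = \<one>\<^bsub>M\<^esub>}"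

definition right_inverses :: "('a, 'b) monoid_scheme \<Rightarrow> 'a \<Rightarrow> 'a set" where
  "right_inverses M a = {b \<in> carrier M. a \<otimes>\<^bsub>M\<^esub> b = \<one>\<^bsub>M\<^esub>}"

definition left_inverses :: "('a, 'b) monoid_scheme \<Rightarrow> 'a \<Rightarrow> 'a set" where
  "left_inverses M a = {b \<in> carrier M. b \<otimes>\<^bsub>M\<^esub> a = \<one>\<^bsub>M\<^esub>}"

text \<open>The witnesses \<open>c\<close> and \<open>d\<close> range over the carrier of \<open>K\<close>. When \<open>K\<close> is a submonoid of
  some \<open>M\<close>, written \<open>M\<lparr>carrier := H\<rparr>\<close>, they must therefore lie in \<open>H\<close>, not merely in \<open>M\<close>.\<close>

definition two_sided_le :: "('a, 'b) monoid_scheme \<Rightarrow> 'a \<Rightarrow> 'a \<Rightarrow> bool" where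
  "two_sided_le K a b \<longleftrightarrow>
    (\<exists>c\<in>carrier K. \<exists>d\<in>carrier K. b = a \<otimes>\<^bsub>K\<^esub> c \<and> b = d \<otimes>\<^bsub>K\<^esub> a)"

definition infinite_ascending_chain :: "('a, 'b) monoid_scheme \<Rightarrow> (nat \<Rightarrow> 'a) \<Rightarrow> bool" where
  "infinite_ascending_chain K x \<longleftrightarrow>
    range x \<subseteq> carrier K \<and> inj x \<and> (\<forall>i. two_sided_le K (x i) (x (Suc i)))"

lemma right_invertibles_submonoid:
  assumes "monoid M"
  shows "submonoid (right_invertibles M) M"
proof -
  interpret monoid M by fact
  show ?thesis
  proof
    fix x y assume "x \<in> right_invertibles M" "y \<in> right_invertibles M"
    then obtain b c where *: "x \<in> carrier M" "y \<in> carrier M" "b \<in> carrier M" "c \<in> carrier M"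
      "x \<otimes>\<^bsub>M\<^esub> b = \<one>\<^bsub>M\<^esub>" "y \<otimes>\<^bsub>M\<^esub> c = \<one>\<^bsub>M\<^esub>"
      by (auto simp: right_invertibles_def)
    have "(x \<otimes>\<^bsub>M\<^esub> y) \<otimes>\<^bsub>M\<^esub> (c \<otimes>\<^bsub>M\<^esub> b) = x \<otimes>\<^bsub>M\<^esub> ((y \<otimes>\<^bsub>M\<^esub> c) \<otimes>\<^bsub>M\<^esub> b)"
      using *(1-4) by (simp add: m_assoc)
    then have "(x \<otimes>\<^bsub>M\<^esub> y) \<otimes>\<^bsub>M\<^esub> (c \<otimes>\<^bsub>M\<^esub> b) = \<one>\<^bsub>M\<^esub>"
      using * by simp
    then show "x \<otimes>\<^bsub>M\<^esub> y \<in> right_invertibles M"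
      using * by (auto simp: right_invertibles_def)
  qed (auto simp: right_invertibles_def)
qed

lemma left_invertibles_submonoid:
  assumes "monoid M"
  shows "submonoid (left_invertibles M) M"
proof -
  interpret monoid M by fact
  show ?thesis
  proof
    fix x y assume "x \<in> left_invertibles M" "y \<in> left_invertibles M"
    then obtain b c where *: "x \<in> carrier M" "y \<in> carrier M" "b \<in> carrier M" "c \<in> carrier M"
      "b \<otimes>\<^bsub>M\<^esub> x = \<one>\<^bsub>M\<^esub>" "c \<otimes>\<^bsub>M\<^esub> y = \<one>\<^bsub>M\<^esub>"
      by (auto simp: left_invertibles_def)
    have "(c \<otimes>\<^bsub>M\<^esub> b) \<otimes>\<^bsub>M\<^esub> (x \<otimes>\<^bsub>M\<^esub> y) = c \<otimes>\<^bsub>M\<^esub> ((b \<otimes>\<^bsub>M\<^esub> x) \<otimes>\<^bsub>M\<^esub> y)"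
      using *(1-4) by (simp add: m_assoc)
    then have "(c \<otimes>\<^bsub>M\<^esub> b) \<otimes>\<^bsub>M\<^esub> (x \<otimes>\<^bsub>M\<^esub> y) = \<one>\<^bsub>M\<^esub>"
      using * by simp
    then show "x \<otimes>\<^bsub>M\<^esub> y \<in> left_invertibles M"
      using * by (auto simp: left_invertibles_def)
  qed (auto simp: left_invertibles_def)
qed

end

theory Submission
  imports Defs
begin

text \<open>If every one-sided invertible element is a unit, then so is every factor of \<open>1\<close>, and the
  only obstruction to (1) is that the group of units is infinite; any injective sequence of units is
  then an ascending chain. Otherwise there are \<open>a\<close>, \<open>b\<close> with \<open>ab = 1 \<noteq> ba\<close>, and the powers of \<open>a\<close>
  and of \<open>b\<close> are the required chains. If \<open>x\<close> and \<open>y = dx\<close> share a right inverse \<open>c\<close>, then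
  \<open>d = dxc = yc = 1\<close>, hence \<open>x = y\<close>, so the members of a chain have disjoint sets of right inverses.
  The claims for left inverses follow by passing to the opposite monoid.\<close>

section \<open>Passing to the opposite monoid\<close>

definition opposite_monoid :: "('a, 'b) monoid_scheme \<Rightarrow> ('a, 'b) monoid_scheme" where
  "opposite_monoid M = M\<lparr>mult := \<lambda>x y. y \<otimes>\<^bsub>M\<^esub> x\<rparr>"

lemma opposite_monoid_simps [simp]:
  "carrier (opposite_monoid M) = carrier M"
  "x \<otimes>\<^bsub>opposite_monoid M\<^esub> y = y \<otimes>\<^bsub>M\<^esub> x"
  "\<one>\<^bsub>opposite_monoid M\<^esub> = \<one>\<^bsub>M\<^esub>"
  by (simp_all add: opposite_monoid_def)

lemma opposite_monoid_is_monoid: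
  assumes "monoid M"
  shows "monoid (opposite_monoid M)"
proof -
  interpret monoid M by fact
  show ?thesis by unfold_locales (auto simp: m_assoc)
qed

lemma right_invertibles_opposite: "right_invertibles (opposite_monoid M) = left_invertibles M"
  by (simp add: right_invertibles_def left_invertibles_def)

lemma right_inverses_opposite: "right_inverses (opposite_monoid M) a = left_inverses M a"
  by (simp add: right_inverses_def left_inverses_def)

lemma Units_opposite: "Units (opposite_monoid M) = Units M"
  by (auto simp: Units_def)

text \<open>Reversing the product swaps the conditions \<open>b = ac\<close> and
  \<open>b = da\<close>, so the chain condition is self-dual.\<close>

lemma infinite_ascending_chain_opposite:
  "infinite_ascending_chain ((opposite_monoid M)\<lparr>carrier := H\<rparr>) x \<longleftrightarrow>
    infinite_ascending_chain (M\<lparr>carrier := H\<rparr>) x"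
  by (auto simp: infinite_ascending_chain_def two_sided_le_def)

section \<open>Right inverses along an ascending chain\<close>

lemma two_sided_le_carrier_update:
  "two_sided_le (M\<lparr>carrier := H\<rparr>) a b \<longleftrightarrow>
    (\<exists>c\<in>H. \<exists>d\<in>H. b = a \<otimes>\<^bsub>M\<^esub> c \<and> b = d \<otimes>\<^bsub>M\<^esub> a)"
  by (simp add: two_sided_le_def)

text \<open>The left factors between consecutive members multiply up. Their product is located only
  in \<open>carrier M\<close>, because \<open>H\<close> is an arbitrary subset and may fail to be
  closed under multiplication.\<close>

lemma infinite_ascending_chain_left_factor:
  assumes "monoid M" "H \<subseteq> carrier M" "infinite_ascending_chain (M\<lparr>carrier := H\<rparr>) x" "i \<le> j"
  shows "\<exists>d\<in>carrier M. x j = d \<otimes>\<^bsub>M\<^esub> x i"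
  using \<open>i \<le> j\<close>
proof (induction j rule: dec_induct)
  case base
  interpret monoid M by fact
  have "x i \<in> carrier M"
    using assms(2,3) by (auto simp: infinite_ascending_chain_def)
  then show ?case by (intro bexI[of _ "\<one>\<^bsub>M\<^esub>"]) auto
next
  case (step j)
  interpret monoid M by fact
  obtain d where d: "d \<in> carrier M" "x j = d \<otimes>\<^bsub>M\<^esub> x i"
    using step.IH by blast
  obtain e where e: "e \<in> carrier M" "x (Suc j) = e \<otimes>\<^bsub>M\<^esub> x j"
    using assms(2,3) unfolding infinite_ascending_chain_def two_sided_le_carrier_update by blast
  have "x i \<in> carrier M"
    using assms(2,3) by (auto simp: infinite_ascending_chain_def)
  with d e have "x (Suc j) = (e \<otimes>\<^bsub>M\<^esub> d) \<otimes>\<^bsub>M\<^esub> x i"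
    by (simp add: m_assoc)
  with d e show ?case by blast
qed

lemma infinite_ascending_chain_right_inverses_disjoint:
  assumes "monoid M" "H \<subseteq> carrier M" "infinite_ascending_chain (M\<lparr>carrier := H\<rparr>) x" "i \<noteq> j"
  shows "right_inverses M (x i) \<inter> right_inverses M (x j) = {}"
proof -
  interpret monoid M by fact
  have carr: "x i \<in> carrier M" for i
    using assms(2,3) by (auto simp: infinite_ascending_chain_def)
  \<comment> \<open>The left factor goes from the smaller index to the larger; the claim itself is
    symmetric in \<open>i\<close> and \<open>j\<close>.\<close>
  have *: "right_inverses M (x i) \<inter> right_inverses M (x j) = {}" if "i < j" for i j
  proof (rule ccontr)
    assume "right_inverses M (x i) \<inter> right_inverses M (x j) \<noteq> {}"
    then obtain c where c: "c \<in> carrier M" "x i \<otimes>\<^bsub>M\<^esub> c = \<one>\<^bsub>M\<^esub>" "x j \<otimes>\<^bsub>M\<^esub> c = \<one>\<^bsub>M\<^esub>"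
      by (auto simp: right_inverses_def)
    obtain d where d: "d \<in> carrier M" "x j = d \<otimes>\<^bsub>M\<^esub> x i"
      using infinite_ascending_chain_left_factor[OF assms(1-3)] \<open>i < j\<close> by (meson less_imp_le)
    have "d = d \<otimes>\<^bsub>M\<^esub> (x i \<otimes>\<^bsub>M\<^esub> c)" using c d by simp
    also have "\<dots> = x j \<otimes>\<^bsub>M\<^esub> c" using c(1) d carr by (simp add: m_assoc)
    finally have "x j = x i" using c d carr by simp
    then show False
      using assms(3) \<open>i < j\<close> by (auto simp: infinite_ascending_chain_def inj_eq)
  qed
  show ?thesis
    using *[of i j] *[of j i] \<open>i \<noteq> j\<close> by (metis Int_commute nat_neq_iff)
qed

section \<open>Chains of right invertible elements\<close>

text \<open>Any two units \<open>u\<close>, \<open>v\<close> are comparable: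
  \<open>v = u (inv u v) = (v inv u) u\<close>, and both witnesses are again units, hence right
  invertible.\<close>

lemma infinite_ascending_chain_Units:
  assumes "monoid M" "infinite (Units M)"
  shows "\<exists>x. infinite_ascending_chain (M\<lparr>carrier := right_invertibles M\<rparr>) x"
proof -
  interpret monoid M by fact
  obtain x :: "nat \<Rightarrow> 'a" where x: "inj x" "range x \<subseteq> Units M"
    using assms(2) infinite_countable_subset by blast
  have sub: "Units M \<subseteq> right_invertibles M"
    by (auto simp: Units_def right_invertibles_def)
  have "two_sided_le (M\<lparr>carrier := right_invertibles M\<rparr>) (x i) (x (Suc i))" for i
  proof -
    have u: "x i \<in> Units M" "x (Suc i) \<in> Units M" using x by auto
    have "inv\<^bsub>M\<^esub> x i \<otimes>\<^bsub>M\<^esub> x (Suc i) \<in> right_invertibles M"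
      "x (Suc i) \<otimes>\<^bsub>M\<^esub> inv\<^bsub>M\<^esub> x i \<in> right_invertibles M"
      using u sub by (auto intro!: subsetD[OF sub])
    moreover have "x (Suc i) = x i \<otimes>\<^bsub>M\<^esub> (inv\<^bsub>M\<^esub> x i \<otimes>\<^bsub>M\<^esub> x (Suc i))"
      using u m_assoc[of "x i" "inv\<^bsub>M\<^esub> x i" "x (Suc i)"] by (simp add: Units_closed)
    moreover have "x (Suc i) = (x (Suc i) \<otimes>\<^bsub>M\<^esub> inv\<^bsub>M\<^esub> x i) \<otimes>\<^bsub>M\<^esub> x i"
      using u by (simp add: Units_closed m_assoc)
    ultimately show ?thesis
      by (simp only: two_sided_le_carrier_update) blast
  qed
  then show ?thesis
    using x sub by (auto simp: infinite_ascending_chain_def)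
qed

lemma (in monoid) pow_right_inverse:
  assumes "a \<in> carrier G" "b \<in> carrier G" "a \<otimes> b = \<one>"
  shows "a [^] (n::nat) \<otimes> b [^] n = \<one>"
proof (induction n)
  case (Suc n)
  \<comment> \<open>Splitting one \<open>a\<close> off on the right and one \<open>b\<close> off on
    the left makes \<open>a \<otimes> b\<close> appear in the middle, where it cancels.\<close>
  have "a [^] Suc n \<otimes> b [^] Suc n = (a [^] n \<otimes> a) \<otimes> (b \<otimes> b [^] n)"
    using assms(1,2) nat_pow_Suc nat_pow_Suc2 by metis
  also have "\<dots> = a [^] n \<otimes> ((a \<otimes> b) \<otimes> b [^] n)"
    using assms(1,2) by (simp add: m_assoc)
  finally have "a [^] Suc n \<otimes> b [^] Suc n = a [^] n \<otimes> ((a \<otimes> b) \<otimes> b [^] n)" .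
  then show ?case using assms Suc by simp
qed simp

text \<open>Consecutive powers are comparable since \<open>a\<close> commutes with its powers. They
  are distinct because a repetition would make some positive power of \<open>a\<close> equal to
  \<open>\<one>\<close>, and \<open>a\<close> would be a unit with inverse \<open>b\<close>.\<close>

lemma infinite_ascending_chain_pow:
  assumes "monoid M" "a \<in> carrier M" "b \<in> carrier M"
    and "a \<otimes>\<^bsub>M\<^esub> b = \<one>\<^bsub>M\<^esub>" "b \<otimes>\<^bsub>M\<^esub> a \<noteq> \<one>\<^bsub>M\<^esub>"
  shows "infinite_ascending_chain (M\<lparr>carrier := right_invertibles M\<rparr>) (\<lambda>i::nat. a [^]\<^bsub>M\<^esub> i)"
proof -
  interpret monoid M by fact
  have a: "a \<in> right_invertibles M"
    using assms by (auto simp: right_invertibles_def)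
  have "a [^]\<^bsub>M\<^esub> i \<noteq> a [^]\<^bsub>M\<^esub> j" if "i < j" for i j :: nat
  proof
    assume eq: "a [^]\<^bsub>M\<^esub> i = a [^]\<^bsub>M\<^esub> j"
    \<comment> \<open>The difference is positive, and writing it as \<open>Suc k\<close> allows one
      factor \<open>a\<close> to be split off below.\<close>
    obtain k where "j = Suc k + i"
      using \<open>i < j\<close> by (metis add.commute add_Suc_right less_imp_Suc_add)
    then have "a [^]\<^bsub>M\<^esub> i = a [^]\<^bsub>M\<^esub> Suc k \<otimes>\<^bsub>M\<^esub> a [^]\<^bsub>M\<^esub> i"
      using eq nat_pow_mult[OF assms(2), of "Suc k" i] by metis
    \<comment> \<open>Multiplying by the \<open>i\<close>-th power of \<open>b\<close> on the right
      cancels the \<open>i\<close>-th power of \<open>a\<close>.\<close>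
    then have "a [^]\<^bsub>M\<^esub> i \<otimes>\<^bsub>M\<^esub> b [^]\<^bsub>M\<^esub> i = a [^]\<^bsub>M\<^esub> Suc k \<otimes>\<^bsub>M\<^esub> (a [^]\<^bsub>M\<^esub> i \<otimes>\<^bsub>M\<^esub> b [^]\<^bsub>M\<^esub> i)"
      using assms(2,3) m_assoc[of "a [^]\<^bsub>M\<^esub> Suc k" "a [^]\<^bsub>M\<^esub> i" "b [^]\<^bsub>M\<^esub> i"] nat_pow_closed by metis
    then have 1: "a [^]\<^bsub>M\<^esub> k \<otimes>\<^bsub>M\<^esub> a = \<one>\<^bsub>M\<^esub>"
      using assms pow_right_inverse by simp
    \<comment> \<open>A left inverse and a right inverse of \<open>a\<close> coincide.\<close>
    then have "a [^]\<^bsub>M\<^esub> k = b"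
      using inv_unique[OF 1] assms by auto
    with 1 assms show False by simp
  qed
  then have "inj (\<lambda>i::nat. a [^]\<^bsub>M\<^esub> i)"
    by (metis injI nat_neq_iff)
  moreover have "a [^]\<^bsub>M\<^esub> i \<in> right_invertibles M" for i :: nat
    using assms pow_right_inverse by (auto simp: right_invertibles_def)
  \<comment> \<open>The element \<open>a\<close> itself serves as both witnesses.\<close>
  moreover have "two_sided_le (M\<lparr>carrier := right_invertibles M\<rparr>) (a [^]\<^bsub>M\<^esub> i) (a [^]\<^bsub>M\<^esub> Suc i)"
    for i :: nat
    unfolding two_sided_le_carrier_update
    using a nat_pow_Suc nat_pow_Suc2[OF assms(2)] by blast
  ultimately show ?thesis
    by (simp add: infinite_ascending_chain_def image_subset_iff del: nat_pow_Suc)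
qed

lemma infinite_ascending_chain_right_invertibles:
  assumes "monoid M"
    and "infinite (Units M) \<or>
      (\<exists>a\<in>carrier M. \<exists>b\<in>carrier M. a \<otimes>\<^bsub>M\<^esub> b = \<one>\<^bsub>M\<^esub> \<and> b \<otimes>\<^bsub>M\<^esub> a \<noteq> \<one>\<^bsub>M\<^esub>)"
  shows "\<exists>x. infinite_ascending_chain (M\<lparr>carrier := right_invertibles M\<rparr>) x"
  using assms(2)
proof
  assume "infinite (Units M)"
  then show ?thesis by (rule infinite_ascending_chain_Units[OF assms(1)])
qed (use infinite_ascending_chain_pow[OF assms(1)] in metis)

section \<open>The versions for left invertible elements\<close>

text \<open>The hypothesis is self-dual: reversing the product preserves the units and exchanges the
  roles of \<open>a\<close> and \<open>b\<close>.\<close>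

lemma infinite_ascending_chain_left_invertibles:
  assumes "monoid M"
    and "infinite (Units M) \<or>
      (\<exists>a\<in>carrier M. \<exists>b\<in>carrier M. a \<otimes>\<^bsub>M\<^esub> b = \<one>\<^bsub>M\<^esub> \<and> b \<otimes>\<^bsub>M\<^esub> a \<noteq> \<one>\<^bsub>M\<^esub>)"
  shows "\<exists>x. infinite_ascending_chain (M\<lparr>carrier := left_invertibles M\<rparr>) x"
proof -
  have "\<exists>x. infinite_ascending_chain
      ((opposite_monoid M)\<lparr>carrier := right_invertibles (opposite_monoid M)\<rparr>) x"
    by (rule infinite_ascending_chain_right_invertibles[OF opposite_monoid_is_monoid])
      (use assms in \<open>auto simp: Units_opposite\<close>)
  then show ?thesis
    by (simp add: infinite_ascending_chain_opposite right_invertibles_opposite)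
qed

lemma infinite_ascending_chain_left_inverses_disjoint:
  assumes "monoid M" "H \<subseteq> carrier M" "infinite_ascending_chain (M\<lparr>carrier := H\<rparr>) x" "i \<noteq> j"
  shows "left_inverses M (x i) \<inter> left_inverses M (x j) = {}"
  using infinite_ascending_chain_right_inverses_disjoint[OF opposite_monoid_is_monoid, of M H x i j]
    assms
  by (simp add: infinite_ascending_chain_opposite right_inverses_opposite)

section \<open>Finiteness and two-sided inverses\<close>

text \<open>A chain is injective by definition; this is why (1) and (2) exclude each other.\<close>

lemma infinite_if_infinite_ascending_chain:
  assumes "infinite_ascending_chain K x"
  shows "infinite (carrier K)"
  using assms unfolding infinite_ascending_chain_def
  by (metis finite_imageD finite_subset infinite_UNIV_nat)

text \<open>The assumption \<open>comm\<close> says that \<open>M\<close> is Dedekind-finite. The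
  case of \<open>unit_factors\<close> applies it twice: once to rotate \<open>bac = 1\<close> into
  \<open>cba = 1\<close>, and once to turn the left inverse \<open>cb\<close> of \<open>a\<close>
  into a two-sided one.\<close>

lemma invertibles_eq_Units:
  assumes "monoid M"
    and comm: "\<And>a b. \<lbrakk>a \<in> carrier M; b \<in> carrier M; a \<otimes>\<^bsub>M\<^esub> b = \<one>\<^bsub>M\<^esub>\<rbrakk> \<Longrightarrow> b \<otimes>\<^bsub>M\<^esub> a = \<one>\<^bsub>M\<^esub>"
  shows "right_invertibles M = Units M" "left_invertibles M = Units M" "unit_factors M = Units M"
proof -
  interpret monoid M by fact
  show "right_invertibles M = Units M" "left_invertibles M = Units M"
    unfolding right_invertibles_def left_invertibles_def Units_def using comm by blast+
  show "unit_factors M = Units M"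
  proof
    show "Units M \<subseteq> unit_factors M"
    proof
      fix u assume u: "u \<in> Units M"
      then have "\<one>\<^bsub>M\<^esub> \<otimes>\<^bsub>M\<^esub> u \<otimes>\<^bsub>M\<^esub> inv\<^bsub>M\<^esub> u = \<one>\<^bsub>M\<^esub>" by (simp add: Units_closed)
      with u show "u \<in> unit_factors M"
        unfolding unit_factors_def by blast
    qed
    show "unit_factors M \<subseteq> Units M"
    proof
      fix a assume "a \<in> unit_factors M"
      then obtain b c where *: "a \<in> carrier M" "b \<in> carrier M" "c \<in> carrier M"
        "b \<otimes>\<^bsub>M\<^esub> a \<otimes>\<^bsub>M\<^esub> c = \<one>\<^bsub>M\<^esub>"
        by (auto simp: unit_factors_def)
      have left: "(c \<otimes>\<^bsub>M\<^esub> b) \<otimes>\<^bsub>M\<^esub> a = \<one>\<^bsub>M\<^esub>"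
        using comm[of "b \<otimes>\<^bsub>M\<^esub> a" c] * by (simp add: m_assoc)
      have "a \<otimes>\<^bsub>M\<^esub> (c \<otimes>\<^bsub>M\<^esub> b) = \<one>\<^bsub>M\<^esub>"
        using * by (intro comm[OF _ _ left]) simp_all
      with left * show "a \<in> Units M"
        unfolding Units_def by blast
    qed
  qed
qed

section \<open>The dichotomy between a finite group and infinite chains\<close>

theorem theorem3:
  fixes M :: "('a, 'b) monoid_scheme"
  assumes "monoid M"
  shows
    "(right_invertibles M = left_invertibles M \<and> left_invertibles M = unit_factors M \<and>
      group (M\<lparr>carrier := unit_factors M\<rparr>) \<and> finite (unit_factors M))
     \<longleftrightarrow>
     \<not> ((\<exists>x. infinite_ascending_chain (M\<lparr>carrier := right_invertibles M\<rparr>) x) \<and>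
        (\<exists>y. infinite_ascending_chain (M\<lparr>carrier := left_invertibles M\<rparr>) y) \<and>
        (\<exists>S S'. S \<subseteq> right_invertibles M \<and> infinite S \<and>
                S' \<subseteq> left_invertibles M \<and> infinite S' \<and>
                (\<forall>s\<in>S. \<forall>t\<in>S. s \<noteq> t \<longrightarrow> right_inverses M s \<inter> right_inverses M t = {}) \<and>
                (\<forall>s\<in>S'. \<forall>t\<in>S'. s \<noteq> t \<longrightarrow> left_inverses M s \<inter> left_inverses M t = {})))"
    (is "?one \<longleftrightarrow> \<not> ?two")
proof
  \<comment> \<open>This direction shows that (1) and (2) cannot both hold; the converse shows that
    at least one of them does.\<close>
  assume "right_invertibles M = left_invertibles M \<and> left_invertibles M = unit_factors M \<and>
    group (M\<lparr>carrier := unit_factors M\<rparr>) \<and> finite (unit_factors M)"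
  then have "finite (right_invertibles M)" by simp
  then have "\<nexists>x. infinite_ascending_chain (M\<lparr>carrier := right_invertibles M\<rparr>) x"
    using infinite_if_infinite_ascending_chain by fastforce
  then show "\<not> ?two" by blast
next
  assume not_two: "\<not> ?two"
  let ?R = "M\<lparr>carrier := right_invertibles M\<rparr>"
  let ?L = "M\<lparr>carrier := left_invertibles M\<rparr>"
  have sub: "right_invertibles M \<subseteq> carrier M" "left_invertibles M \<subseteq> carrier M"
    by (auto simp: right_invertibles_def left_invertibles_def)
  \<comment> \<open>The ranges of the two chains serve as \<open>S\<close> and \<open>S'\<close>, so
    a pair of chains already yields all of (2).\<close>
  have two: ?two if "infinite_ascending_chain ?R x" "infinite_ascending_chain ?L y" for x y
  proof (intro conjI exI)
    show "infinite_ascending_chain ?R x" "infinite_ascending_chain ?L y" by fact+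
    show "range x \<subseteq> right_invertibles M" "infinite (range x)"
      "range y \<subseteq> left_invertibles M" "infinite (range y)"
      using that by (auto simp: infinite_ascending_chain_def finite_image_iff)
    show "\<forall>s\<in>range x. \<forall>t\<in>range x. s \<noteq> t \<longrightarrow> right_inverses M s \<inter> right_inverses M t = {}"
      using infinite_ascending_chain_right_inverses_disjoint[OF assms sub(1) that(1)]
      by (metis rangeE)
    show "\<forall>s\<in>range y. \<forall>t\<in>range y. s \<noteq> t \<longrightarrow> left_inverses M s \<inter> left_inverses M t = {}"
      using infinite_ascending_chain_left_inverses_disjoint[OF assms sub(2) that(2)]
      by (metis rangeE)
  qed
  \<comment> \<open>Either alternative would produce a chain on both sides. Its failure gives
    exactly the finiteness and the Dedekind-finiteness that (1) rests on.\<close>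
  have "\<not> (infinite (Units M) \<or>
      (\<exists>a\<in>carrier M. \<exists>b\<in>carrier M. a \<otimes>\<^bsub>M\<^esub> b = \<one>\<^bsub>M\<^esub> \<and> b \<otimes>\<^bsub>M\<^esub> a \<noteq> \<one>\<^bsub>M\<^esub>))"
  proof
    assume *: "infinite (Units M) \<or>
      (\<exists>a\<in>carrier M. \<exists>b\<in>carrier M. a \<otimes>\<^bsub>M\<^esub> b = \<one>\<^bsub>M\<^esub> \<and> b \<otimes>\<^bsub>M\<^esub> a \<noteq> \<one>\<^bsub>M\<^esub>)"
    obtain x where "infinite_ascending_chain ?R x"
      using infinite_ascending_chain_right_invertibles[OF assms *] ..
    moreover obtain y where "infinite_ascending_chain ?L y"
      using infinite_ascending_chain_left_invertibles[OF assms *] ..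
    ultimately have ?two by (rule two)
    with not_two show False by (rule notE)
  qed
  then have fin: "finite (Units M)"
    and comm: "\<And>a b. \<lbrakk>a \<in> carrier M; b \<in> carrier M; a \<otimes>\<^bsub>M\<^esub> b = \<one>\<^bsub>M\<^esub>\<rbrakk> \<Longrightarrow> b \<otimes>\<^bsub>M\<^esub> a = \<one>\<^bsub>M\<^esub>"
    by blast+
  have "group (M\<lparr>carrier := Units M\<rparr>)"
  proof -
    interpret monoid M by fact
    show ?thesis
      by (rule groupI) (simp_all add: m_assoc Units_closed, use Units_l_inv Units_inv_Units in blast)
  qed
  \<comment> \<open>All three sets become \<open>Units M\<close>, which leaves only the group
    property and finiteness.\<close>
  then show ?one
    using fin by (simp only: invertibles_eq_Units[OF assms comm])
qed

end
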